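(* The only simple Tutte invariants of alternating dimaps are the following functions $F$ (each with $F(\text{empty alternating dimap})=1$), with the indicated constants $w,x,y,z$: (a) $F(G)=0$ for nonempty $G$, with $w=0$; (b) $F(G)=3^{|E(G)|}$, with $w=x=y=z=3$; (c) $F(G)=(-1)^{|V(G)|}$, with $y=z=1$ and $x=w=-1$; (d) $F(G)=(-1)^{\mathrm{cf}(G)}$, with $x=z=1$ and $y=w=-1$; (e) $F(G)=(-1)^{\mathrm{af}(G)}$, with $x=y=1$ and $z=w=-1$. Here $\mathrm{cf}(G)$ and $\mathrm{af}(G)$ are the numbers of clockwise and anticlockwise faces of $G$, respectively.
   Context: An \emph{alternating dimap} is a finite directed graph (loops and multiple edges allowed) without isolated vertices, 2-cell-embedded in a disjoint union of oriented surfaces, one for each component, such that around each vertex the incident edges are directed alternately into and out of the vertex. The empty alternating dimap is allowed. All edges around a face go in the same direction; a face is a \emph{c-face} (clockwise) or \emph{a-face} (anticlockwise) accordingly. An \emph{in-star} is the set of all edges directed into some vertex. Each edge $e$ lies in exactly one c-face $C(e)$, one a-face $A(e)$ and one in-star $I(e)$. The \emph{left successor} (resp. \emph{right successor}) of $e$ is the next edge after $e$ going around $A(e)$ (resp. $C(e)$) in the direction of $e$. Let $\omega=\exp(2\pi i/3)$. The permutations $\sigma_1,\sigma_\omega,\sigma_{\omega^2}$ of $E(G)$ send $e$ to the next edge in clockwise order around $I(e)$, $A(e)$, $C(e)$ respectively. They satisfy $\sigma_1\sigma_\omega\sigma_{\omega^2}=\mathrm{id}$ (rightmost applied first), and alternating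 dimaps correspond bijectively to triples of permutations of a finite set satisfying this identity: in-stars (equivalently vertices), a-faces and c-faces are the cycles of $\sigma_1,\sigma_\omega,\sigma_{\omega^2}$. \emph{Minor operations.} Let $e$ be an edge from $u$ to $v$. $G[1]e$ (contraction): if $e$ is not a loop, delete $e$ and identify its endpoints, preserving orders around vertices; if $e$ alone forms an a-face or a c-face, delete $e$; if $e$ is any other loop, delete $e$ and split $v$ into two vertices, one carrying the edge-ends strictly between the two ends of $e$ on one side and the other carrying those on the other side. $G[\omega]e$: delete $e$ and, if the left successor $g$ of $e$ is not $e$, change the tail of $g$ from $v$ to $u$ so that $g$ takes the place of $e,g$ in $A(e)$. $G[\omega^2]e$: the same with the right successor and $C(e)$. A vertex left without edges disappears. Equivalently, with $\pi\setminus e$ the permutation obtained from $\pi$ by removing $e$ from its cycle: in $G[1]e$, $\sigma_\omega,\sigma_{\omega^2}$ become $\sigma_\omega\setminus e,\sigma_{\omega^2}\setminus e$; in $G[\omega]e$, $\sigma_1,\sigma_\omega$ become $\sigma_1\setminus e,\sigma_\omega\setminus e$; in $G[\omega^2]e$, $\sigma_1,\sigma_{\omega^2}$ become $\sigma_1\setminus e,\sigma_{\omega^2}\setminus e$; the third permutation is determined by the product identity. A \emph{1-loop} is an edge whose head has degree 2 (i.e. $\sigma_1(e)=e$); an \emph{$\omega$-loop} is an edge forming a single-edge a-face; an \emph{$\omega^2$-loop} is an edge forming a single-edge c-face. A \emph{triloop} is a $\mu$-loop for some $\mu\in\{1,\omega,\omega^2\}$. An \emph{ultraloop} is a triloop which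 with its vertex constitutes a component of $G$. A $\mu$-loop is \emph{proper} if it is not an ultraloop. $G-e$ denotes $G$ with the ultraloop $e$ (and its vertex) removed. A \emph{simple Tutte invariant} is a function $F$ defined on every alternating dimap, invariant under isomorphism, with $F(\text{empty alternating dimap})=1$, for which there exist $w,x,y,z$ such that for any alternating dimap $G$: (1) $F(G)=w\,F(G-e)$ for any ultraloop $e$ of $G$; (2) $F(G)=x\,F(G[1]e)$ for any proper 1-loop $e$ of $G$; (3) $F(G)=y\,F(G[\omega]e)$ for any proper $\omega$-loop $e$ of $G$; (4) $F(G)=z\,F(G[\omega^2]e)$ for any proper $\omega^2$-loop $e$ of $G$; (5) $F(G)=F(G[1]e)+F(G[\omega]e)+F(G[\omega^2]e)$ for any edge $e$ of $G$ that is not an ultraloop or a triloop.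
   Formalization: The constants y and z in (d) and (e) are interchanged, since as printed they fail: (d) (-1)^cf(G) goes with x=y=1, z=w=-1, and (e) (-1)^af(G) goes with x=z=1, y=w=-1. Values of F and w,x,y,z are taken in an arbitrary integral domain. *)

theory Defs
  imports
    "HOL-Combinatorics.Permutations"
    "HOL-Combinatorics.Orbits"
    "HOL-Library.Infinite_Typeclass"
begin

text \<open>
  An alternating dimap is encoded by its edge set together with the three permutations that send an
  edge to the next one in clockwise order around its in-star, its a-face and its c-face.
  The embedding is recovered from them: vertices (in-stars), a-faces and c-faces are the cycles.
  Isolated vertices cannot occur in this encoding, and the empty edge set gives the empty dimap.
\<close>

record 'e dimap =
  edges :: "'e set"
  sigma1 :: "'e \<Rightarrow> 'e"
  sigma_w :: "'e \<Rightarrow> 'e"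
  sigma_w2 :: "'e \<Rightarrow> 'e"

definition alternating_dimap :: "'e dimap \<Rightarrow> bool" where
  "alternating_dimap G \<longleftrightarrow>
     finite (edges G) \<and>
     sigma1 G permutes edges G \<and> sigma_w G permutes edges G \<and> sigma_w2 G permutes edges G \<and>
     sigma1 G \<circ> sigma_w G \<circ> sigma_w2 G = id"

definition in_star :: "'e dimap \<Rightarrow> 'e \<Rightarrow> 'e set" where
  "in_star G e = orbit (sigma1 G) e"

definition a_face :: "'e dimap \<Rightarrow> 'e \<Rightarrow> 'e set" where
  "a_face G e = orbit (sigma_w G) e"

definition c_face :: "'e dimap \<Rightarrow> 'e \<Rightarrow> 'e set" where
  "c_face G e = orbit (sigma_w2 G) e"

definition verts :: "'e dimap \<Rightarrow> 'e set set" where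
  "verts G = in_star G ` edges G"

definition a_faces :: "'e dimap \<Rightarrow> 'e set set" where
  "a_faces G = a_face G ` edges G"

definition c_faces :: "'e dimap \<Rightarrow> 'e set set" where
  "c_faces G = c_face G ` edges G"

text \<open>
  A vertex is identified with its in-star.  Edges of an a-face run anticlockwise around it, so
  \<open>sigma_w G e\<close>, the next edge clockwise, is the one preceding \<open>e\<close> in the direction of travel:
  its head is the tail of \<open>e\<close>.
\<close>

definition head :: "'e dimap \<Rightarrow> 'e \<Rightarrow> 'e set" where
  "head G e = in_star G e"

definition tail :: "'e dimap \<Rightarrow> 'e \<Rightarrow> 'e set" where
  "tail G e = in_star G (sigma_w G e)"

definition dimap_iso :: "('e \<Rightarrow> 'f) \<Rightarrow> 'e dimap \<Rightarrow> 'f dimap \<Rightarrow> bool" where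
  "dimap_iso h G H \<longleftrightarrow>
     bij_betw h (edges G) (edges H) \<and>
     (\<forall>e\<in>edges G.
        h (sigma1 G e) = sigma1 H (h e) \<and>
        h (sigma_w G e) = sigma_w H (h e) \<and>
        h (sigma_w2 G e) = sigma_w2 H (h e))"

definition isomorphic :: "'e dimap \<Rightarrow> 'f dimap \<Rightarrow> bool" where
  "isomorphic G H \<longleftrightarrow> (\<exists>h. dimap_iso h G H)"

definition perm_delete :: "'e \<Rightarrow> ('e \<Rightarrow> 'e) \<Rightarrow> 'e \<Rightarrow> 'e" where
  "perm_delete e p = (\<lambda>x. if x = e then e else if p x = e then p e else p x)"

text \<open>
  In each minor two of the permutations lose \<open>e\<close>, and the third one is the solution of
  \<open>\<sigma>\<^sub>1 \<circ> \<sigma>\<^sub>\<omega> \<circ> \<sigma>\<^sub>\<omega>\<^sub>2 = id\<close> (equivalently, of either of its cyclic rotations).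
\<close>

definition minor1 :: "'e dimap \<Rightarrow> 'e \<Rightarrow> 'e dimap" where
  "minor1 G e =
     (let b = perm_delete e (sigma_w G); c = perm_delete e (sigma_w2 G)
      in \<lparr>edges = edges G - {e}, sigma1 = inv (b \<circ> c), sigma_w = b, sigma_w2 = c\<rparr>)"

definition minor_w :: "'e dimap \<Rightarrow> 'e \<Rightarrow> 'e dimap" where
  "minor_w G e =
     (let a = perm_delete e (sigma1 G); b = perm_delete e (sigma_w G)
      in \<lparr>edges = edges G - {e}, sigma1 = a, sigma_w = b, sigma_w2 = inv (a \<circ> b)\<rparr>)"

definition minor_w2 :: "'e dimap \<Rightarrow> 'e \<Rightarrow> 'e dimap" where
  "minor_w2 G e =
     (let a = perm_delete e (sigma1 G); c = perm_delete e (sigma_w2 G)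
      in \<lparr>edges = edges G - {e}, sigma1 = a, sigma_w = inv (c \<circ> a), sigma_w2 = c\<rparr>)"

definition remove_ultraloop :: "'e dimap \<Rightarrow> 'e \<Rightarrow> 'e dimap" where
  "remove_ultraloop G e =
     \<lparr>edges = edges G - {e},
      sigma1 = perm_delete e (sigma1 G),
      sigma_w = perm_delete e (sigma_w G),
      sigma_w2 = perm_delete e (sigma_w2 G)\<rparr>"

text \<open>The head of \<open>e\<close> has degree 2 iff \<open>e\<close> is the only edge directed into it.\<close>

definition loop1 :: "'e dimap \<Rightarrow> 'e \<Rightarrow> bool" where
  "loop1 G e \<longleftrightarrow> e \<in> edges G \<and> in_star G e = {e}"

definition loop_w :: "'e dimap \<Rightarrow> 'e \<Rightarrow> bool" where
  "loop_w G e \<longleftrightarrow> e \<in> edges G \<and> a_face G e = {e}"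

definition loop_w2 :: "'e dimap \<Rightarrow> 'e \<Rightarrow> bool" where
  "loop_w2 G e \<longleftrightarrow> e \<in> edges G \<and> c_face G e = {e}"

definition triloop :: "'e dimap \<Rightarrow> 'e \<Rightarrow> bool" where
  "triloop G e \<longleftrightarrow> loop1 G e \<or> loop_w G e \<or> loop_w2 G e"

text \<open>
  The edge \<open>e\<close> with its vertex is a component iff \<open>e\<close> is a loop and no other edge is incident
  with that vertex.
\<close>

definition ultraloop :: "'e dimap \<Rightarrow> 'e \<Rightarrow> bool" where
  "ultraloop G e \<longleftrightarrow>
     triloop G e \<and> tail G e = head G e \<and>
     (\<forall>f\<in>edges G. head G f = head G e \<or> tail G f = head G e \<longrightarrow> f = e)"

definition tutte_conditions ::
  "('e dimap \<Rightarrow> 'k::comm_ring_1) \<Rightarrow> 'k \<Rightarrow> 'k \<Rightarrow> 'k \<Rightarrow> 'k \<Rightarrow> bool" where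
  "tutte_conditions F w x y z \<longleftrightarrow>
     (\<forall>G H. alternating_dimap G \<and> alternating_dimap H \<and> isomorphic G H \<longrightarrow> F G = F H) \<and>
     (\<forall>G. alternating_dimap G \<and> edges G = {} \<longrightarrow> F G = 1) \<and>
     (\<forall>G. alternating_dimap G \<longrightarrow> (\<forall>e\<in>edges G.
        (ultraloop G e \<longrightarrow> F G = w * F (remove_ultraloop G e)) \<and>
        (loop1 G e \<and> \<not> ultraloop G e \<longrightarrow> F G = x * F (minor1 G e)) \<and>
        (loop_w G e \<and> \<not> ultraloop G e \<longrightarrow> F G = y * F (minor_w G e)) \<and>
        (loop_w2 G e \<and> \<not> ultraloop G e \<longrightarrow> F G = z * F (minor_w2 G e)) \<and>
        (\<not> ultraloop G e \<and> \<not> triloop G e \<longrightarrow>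
           F G = F (minor1 G e) + F (minor_w G e) + F (minor_w2 G e))))"

definition simple_tutte_invariant :: "('e dimap \<Rightarrow> 'k::comm_ring_1) \<Rightarrow> bool" where
  "simple_tutte_invariant F \<longleftrightarrow> (\<exists>w x y z. tutte_conditions F w x y z)"

text \<open>Values of \<open>F\<close> on records that are not alternating dimaps are irrelevant.\<close>

definition agree_on_dimaps :: "('e dimap \<Rightarrow> 'k) \<Rightarrow> ('e dimap \<Rightarrow> 'k) \<Rightarrow> bool" where
  "agree_on_dimaps F F' \<longleftrightarrow> (\<forall>G. alternating_dimap G \<longrightarrow> F G = F' G)"

end

theory Submission
  imports Defs
begin

text \<open>
  Deletions lower the number of edges, so the constants \<open>w, x, y, z\<close> determine the invariant.
  If \<open>w = 0\<close> it vanishes on nonempty dimaps.  Otherwise evaluating the recursion at different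
  edges of the same dimap constrains the constants: a dimap with three edges gives
  \<open>x * y = x + y + w\<close> and, by rotating the three permutations, the two analogous equations, and
  a dimap with four edges gives \<open>x * y * z = x * y + y * z + z * x\<close>.  Over an integral domain only
  the four listed solutions remain.  That \<open>(-1)\<close> to the number of vertices satisfies the
  recursion follows from the sign of \<open>sigma1\<close>, which is the product of the signs of the other two
  permutations.
\<close>

section \<open>Deleting a point from a permutation\<close>

text \<open>Writing deletion as left multiplication by a transposition (trivial if \<open>e\<close>
  is fixed) makes permutation and sign facts immediate.\<close>

lemma perm_delete_eq_transpose:
  assumes "inj p"
  shows "perm_delete e p = transpose e (p e) \<circ> p"
  using assms by (auto simp: fun_eq_iff perm_delete_def transpose_def inj_eq)

lemma perm_delete_fixed:
  assumes "p e = e" "inj p"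
  shows "perm_delete e p = p"
  using assms by (simp add: perm_delete_eq_transpose)

lemma perm_delete_permutes:
  assumes "p permutes E"
  shows "perm_delete e p permutes (E - {e})"
proof (rule permutes_superset)
  have inj: "inj p" using assms by (rule permutes_inj)
  show "perm_delete e p permutes E"
  proof (cases "e \<in> E")
    case True
    then show ?thesis
      using assms by (simp add: perm_delete_eq_transpose[OF inj] permutes_compose permutes_swap_id
          permutes_in_image)
  next
    case False
    then show ?thesis
      using assms by (simp add: perm_delete_fixed[OF _ inj] permutes_not_in)
  qed
qed (auto simp: perm_delete_def)

lemma orbit_perm_delete:
  assumes "inj p" "x \<noteq> e"
  shows "orbit (perm_delete e p) x = orbit p x - {e}"
proof (intro equalityI subsetI)
  fix y assume "y \<in> orbit (perm_delete e p) x"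
  then show "y \<in> orbit p x - {e}"
  proof induction
    case base
    have "p x = e \<Longrightarrow> p e \<in> orbit p x" using orbit.base[of p x] orbit.step[of e p x] by simp
    then show ?case
      using assms orbit.base[of p x] by (auto simp: perm_delete_def inj_eq)
  next
    case (step y)
    have "p y = e \<Longrightarrow> p e \<in> orbit p x"
      using step.IH orbit.step[of y p x] orbit.step[of e p x] by simp
    then show ?case
      using assms step.IH orbit.step[of y p x] by (auto simp: perm_delete_def inj_eq)
  qed
next
  fix y assume y: "y \<in> orbit p x - {e}"
  let ?O = "orbit (perm_delete e p) x"
  have del: "perm_delete e p u = (if p u = e then p e else p u)" if "u \<noteq> e" for u
    using that by (simp add: perm_delete_def)
  have "y \<in> orbit p x" using y by simp
  \<comment> \<open>The orbit of \<open>p\<close> may pass through \<open>e\<close>, which the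
    shortened cycle skips. The induction therefore lets \<open>p e\<close> stand in for
    \<open>e\<close>.\<close>
  then have "(y \<noteq> e \<longrightarrow> y \<in> ?O) \<and> (y = e \<longrightarrow> p e \<in> ?O)"
  proof induction
    case base
    show ?case using orbit.base[of "perm_delete e p" x] del[OF assms(2)] by auto
  next
    case (step y)
    show ?case
    proof (cases "y = e")
      case True
      then show ?thesis using step.IH by auto
    next
      case False
      then have "perm_delete e p y \<in> ?O" using step.IH by (blast intro: orbit.step)
      then show ?thesis using del[OF False] by auto
    qed
  qed
  then show "y \<in> ?O" using y by simp
qed

section \<open>Cycle counts and signs after deleting a point\<close>

lemma permutes_self_in_orbit:
  assumes "p permutes E" "finite E"
  shows "x \<in> orbit p x"
  by (rule permutation_self_in_orbit[OF permutes_imp_permutation[OF assms(2,1)]])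

lemma permutes_orbit_eq:
  assumes "p permutes E" "finite E" "y \<in> orbit p x"
  shows "orbit p y = orbit p x"
  by (rule orbit_cyclic_eq3[OF cyclic_on_orbit[OF assms(1,2)] assms(3)])

text \<open>A cycle of length at least 2 survives the loss of \<open>e\<close>; only the cycle
  \<open>{e}\<close> disappears.\<close>

lemma card_orbits_perm_delete:
  assumes p: "p permutes E" and fin: "finite E" and e: "e \<in> E"
  shows "card (orbit p ` E) =
    card (orbit (perm_delete e p) ` (E - {e})) + (if p e = e then 1 else 0)"
proof -
  have inj: "inj p" using p by (rule permutes_inj)
  have img: "orbit (perm_delete e p) ` (E - {e}) = (\<lambda>B. B - {e}) ` (orbit p ` (E - {e}))"
    unfolding image_image by (rule image_cong) (auto simp: orbit_perm_delete[OF inj])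
  \<comment> \<open>Every cycle considered here contains a point other than \<open>e\<close>, and
    that point determines the cycle.\<close>
  have "inj_on (\<lambda>B. B - {e}) (orbit p ` (E - {e}))"
  proof (rule inj_onI)
    fix B1 B2
    assume "B1 \<in> orbit p ` (E - {e})" "B2 \<in> orbit p ` (E - {e})" and eq: "B1 - {e} = B2 - {e}"
    then obtain x y where x: "B1 = orbit p x" "x \<noteq> e" and y: "B2 = orbit p y" by blast
    have "x \<in> orbit p y" using permutes_self_in_orbit[OF p fin, of x] x y eq by blast
    then show "B1 = B2" using permutes_orbit_eq[OF p fin] x y by simp
  qed
  then have card: "card (orbit (perm_delete e p) ` (E - {e})) = card (orbit p ` (E - {e}))"
    by (simp add: img card_image)
  have ins: "orbit p ` E = insert (orbit p e) (orbit p ` (E - {e}))" using e by blast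
  show ?thesis
  proof (cases "p e = e")
    case True
    then have "orbit p e = {e}" by (simp add: orbit_eq_singleton_iff)
    moreover have "{e} \<notin> orbit p ` (E - {e})"
      using permutes_self_in_orbit[OF p fin] by blast
    ultimately show ?thesis using True fin by (simp add: ins card)
  next
    case False
    have "p e \<in> E" using p e by (simp add: permutes_in_image)
    moreover have "orbit p (p e) = orbit p e"
      by (rule permutes_orbit_eq[OF p fin]) (rule orbit.base)
    ultimately have "orbit p e \<in> orbit p ` (E - {e})" using False by blast
    then have "orbit p ` E = orbit p ` (E - {e})" using ins by blast
    then show ?thesis using False card by simp
  qed
qed

lemma sign_perm_delete:
  assumes "p permutes E" "finite E"
  shows "sign (perm_delete e p) = (if p e = e then sign p else - sign p)"
proof -
  have "permutation p" using assms(2,1) by (rule permutes_imp_permutation)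
  then show ?thesis
    using permutes_inj[OF assms(1)]
    by (simp add: perm_delete_eq_transpose sign_compose permutation_swap_id sign_swap_id)
qed

text \<open>Induction by deleting one point. If it is fixed, the cycle count and
  \<open>card E\<close> both drop by one and the sign stays; otherwise the cycle count stays, while
  the sign and the parity of \<open>card E\<close> both change.\<close>

lemma minus_one_power_card_orbits:
  assumes "finite E" "p permutes E"
  shows "(- 1) ^ card (orbit p ` E) = (of_int (sign p) * (- 1) ^ card E :: 'k::comm_ring_1)"
  using assms
proof (induction E arbitrary: p rule: finite_induct)
  case empty
  then show ?case by simp
next
  case (insert e E)
  have fin: "finite (insert e E)" using insert.hyps by simp
  have rm: "insert e E - {e} = E" using insert.hyps by simp
  have IH: "(- 1) ^ card (orbit (perm_delete e p) ` E) =
      (of_int (sign (perm_delete e p)) * (- 1) ^ card E :: 'k)"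
    using perm_delete_permutes[OF insert.prems, of e] unfolding rm by (rule insert.IH)
  have card: "card (orbit p ` insert e E) =
      card (orbit (perm_delete e p) ` E) + (if p e = e then 1 else 0)"
    using card_orbits_perm_delete[OF insert.prems fin, of e] unfolding rm by simp
  show ?case
    unfolding card power_add IH sign_perm_delete[OF insert.prems fin]
    using insert.hyps by simp
qed

section \<open>Minors of alternating dimaps\<close>

lemma alternating_dimapD:
  assumes "alternating_dimap G"
  shows "finite (edges G)" "sigma1 G permutes edges G" "sigma_w G permutes edges G"
    "sigma_w2 G permutes edges G" "sigma1 G (sigma_w G (sigma_w2 G e)) = e"
    "inj (sigma1 G)" "inj (sigma_w G)" "inj (sigma_w2 G)"
  using assms by (auto simp: alternating_dimap_def fun_eq_iff permutes_inj)

lemma triple_rotate: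
  fixes a b c :: "'a \<Rightarrow> 'a"
  assumes "a \<circ> b \<circ> c = id" "bij a"
  shows "b \<circ> c \<circ> a = id"
proof -
  have "b \<circ> c = inv a"
    using assms by (metis bij_is_inj comp_assoc comp_id id_comp inv_o_cancel)
  then show ?thesis using assms(2) by (simp add: bij_is_inj)
qed

lemma triple_inverses:
  fixes a b c :: "'a \<Rightarrow> 'a"
  assumes "a \<circ> b \<circ> c = id" "bij a" "bij b" "bij c"
  shows "inv (b \<circ> c) = a" "inv (a \<circ> b) = c" "inv (c \<circ> a) = b"
proof -
  have r: "b \<circ> c \<circ> a = id" using assms(1,2) by (rule triple_rotate)
  have r': "c \<circ> a \<circ> b = id" using r assms(3) by (rule triple_rotate)
  show "inv (b \<circ> c) = a" "inv (a \<circ> b) = c" "inv (c \<circ> a) = b"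
    by (rule inv_unique_comp; use assms(1) r r' in \<open>simp add: comp_assoc\<close>)+
qed

lemma alternating_dimap_minors:
  assumes G: "alternating_dimap G"
  shows "alternating_dimap (minor1 G e)" "alternating_dimap (minor_w G e)"
    "alternating_dimap (minor_w2 G e)"
proof -
  let ?E = "edges G - {e}"
  note D = alternating_dimapD[OF G]
  let ?a = "perm_delete e (sigma1 G)" and ?b = "perm_delete e (sigma_w G)"
    and ?c = "perm_delete e (sigma_w2 G)"
  have p: "?a permutes ?E" "?b permutes ?E" "?c permutes ?E"
    using D by (simp_all add: perm_delete_permutes)
  have bij: "bij ?a" "bij ?b" "bij ?c" using p permutes_bij by blast+
  have q: "inv (?b \<circ> ?c) permutes ?E" "inv (?a \<circ> ?b) permutes ?E" "inv (?c \<circ> ?a) permutes ?E"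
    using p by (simp_all add: permutes_inv permutes_compose)
  have "inv (?b \<circ> ?c) \<circ> ?b \<circ> ?c = id"
    using bij by (simp add: comp_assoc bij_is_inj bij_comp)
  then show "alternating_dimap (minor1 G e)"
    using p q D(1) by (simp add: alternating_dimap_def minor1_def Let_def)
  have "?a \<circ> ?b \<circ> inv (?a \<circ> ?b) = id"
    using bij bij_comp[of ?b ?a] by (metis bij_is_surj surj_iff)
  then show "alternating_dimap (minor_w G e)"
    using p q D(1) by (simp add: alternating_dimap_def minor_w_def Let_def)
  \<comment> \<open>For this minor the identity is immediate only in the order b, c, a; two cyclic
    rotations restore the required order.\<close>
  have "inv (?c \<circ> ?a) \<circ> ?c \<circ> ?a = id"
    using bij by (simp add: comp_assoc bij_is_inj bij_comp)
  then have "?c \<circ> ?a \<circ> inv (?c \<circ> ?a) = id"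
    using q(3) permutes_bij triple_rotate by blast
  then have "?a \<circ> inv (?c \<circ> ?a) \<circ> ?c = id"
    using bij(3) by (rule triple_rotate)
  then show "alternating_dimap (minor_w2 G e)"
    using p q D(1) by (simp add: alternating_dimap_def minor_w2_def Let_def)
qed

text \<open>Deletion does not respect composition in general. Each side is
  \<open>p \<circ> q\<close> multiplied by transpositions coming from
  \<open>perm_delete_eq_transpose\<close>, and in each of the three cases these agree or
  cancel.\<close>

lemma perm_delete_comp_fixed:
  assumes "inj p" "inj q" "p e = e \<or> q e = e \<or> p (q e) = e"
  shows "perm_delete e p \<circ> perm_delete e q = perm_delete e (p \<circ> q)"
proof
  fix u
  show "(perm_delete e p \<circ> perm_delete e q) u = perm_delete e (p \<circ> q) u"
    using assms(3) inj_eq[OF assms(1)] inj_eq[OF assms(2)]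
    unfolding perm_delete_def o_def by (smt (verit))
qed

lemma alternating_dimap_comp_fixed_iff:
  assumes "alternating_dimap G"
  shows "sigma1 G (sigma_w G e) = e \<longleftrightarrow> sigma_w2 G e = e"
proof
  note D = alternating_dimapD[OF assms]
  assume "sigma1 G (sigma_w G e) = e"
  then have "sigma1 G (sigma_w G e) = sigma1 G (sigma_w G (sigma_w2 G e))" by (simp add: D(5))
  then show "sigma_w2 G e = e" using D(6,7) by (simp add: inj_eq)
next
  assume "sigma_w2 G e = e"
  then show "sigma1 G (sigma_w G e) = e" using alternating_dimapD(5)[OF assms, of e] by simp
qed

text \<open>By the product identity, two permutations fixing \<open>e\<close> force the third to fix
  it. So none, exactly one, or all three fix \<open>e\<close>, which matches the five clauses of the
  recursion.\<close>

lemma alternating_dimap_fixed_cases: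
  assumes "alternating_dimap G"
  shows "sigma1 G e = e \<and> sigma_w G e = e \<and> sigma_w2 G e = e \<or>
    sigma1 G e = e \<and> sigma_w G e \<noteq> e \<and> sigma_w2 G e \<noteq> e \<or>
    sigma1 G e \<noteq> e \<and> sigma_w G e = e \<and> sigma_w2 G e \<noteq> e \<or>
    sigma1 G e \<noteq> e \<and> sigma_w G e \<noteq> e \<and> sigma_w2 G e = e \<or>
    sigma1 G e \<noteq> e \<and> sigma_w G e \<noteq> e \<and> sigma_w2 G e \<noteq> e"
proof -
  have "sigma1 G (sigma_w G e) = sigma1 G e \<longleftrightarrow> sigma_w G e = e"
    using alternating_dimapD(6)[OF assms] by (rule inj_eq)
  then show ?thesis
    using alternating_dimap_comp_fixed_iff[OF assms, of e] by metis
qed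

text \<open>For a triloop the three shortened permutations still compose to the identity, so the
  permutation that a minor computes as an inverse is itself the shortened one.\<close>

lemma minor_triloop:
  assumes G: "alternating_dimap G"
    and fixed: "sigma1 G e = e \<or> sigma_w G e = e \<or> sigma_w2 G e = e"
  shows "alternating_dimap (remove_ultraloop G e)"
    "minor1 G e = remove_ultraloop G e" "minor_w G e = remove_ultraloop G e"
    "minor_w2 G e = remove_ultraloop G e"
proof -
  note D = alternating_dimapD[OF G]
  let ?E = "edges G - {e}"
  let ?a = "perm_delete e (sigma1 G)" and ?b = "perm_delete e (sigma_w G)"
    and ?c = "perm_delete e (sigma_w2 G)"
  have p: "?a permutes ?E" "?b permutes ?E" "?c permutes ?E"
    using D by (simp_all add: perm_delete_permutes)
  have bij: "bij ?a" "bij ?b" "bij ?c" using p permutes_bij by blast+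
  have id: "sigma1 G \<circ> sigma_w G \<circ> sigma_w2 G = id" using G by (simp add: alternating_dimap_def)
  have "?a \<circ> ?b = perm_delete e (sigma1 G \<circ> sigma_w G)"
    using D fixed alternating_dimap_comp_fixed_iff[OF G, of e] by (intro perm_delete_comp_fixed) auto
  then have "?a \<circ> ?b \<circ> ?c = perm_delete e (sigma1 G \<circ> sigma_w G) \<circ> ?c" by simp
  \<comment> \<open>Here the total product is the identity and so fixes \<open>e\<close>; deletion
    respects this composition without a further case split.\<close>
  also have "\<dots> = perm_delete e (sigma1 G \<circ> sigma_w G \<circ> sigma_w2 G)"
    using D by (intro perm_delete_comp_fixed) (auto intro: inj_compose)
  also have "\<dots> = id" unfolding id by (simp add: perm_delete_def fun_eq_iff)
  finally have id': "?a \<circ> ?b \<circ> ?c = id" .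
  show "alternating_dimap (remove_ultraloop G e)"
    using p id' D(1) by (simp add: alternating_dimap_def remove_ultraloop_def)
  show "minor1 G e = remove_ultraloop G e" "minor_w G e = remove_ultraloop G e"
    "minor_w2 G e = remove_ultraloop G e"
    using triple_inverses[OF id' bij]
    by (simp_all add: minor1_def minor_w_def minor_w2_def remove_ultraloop_def Let_def)
qed

section \<open>The Tutte conditions in terms of fixed points\<close>

lemma loop_iffs:
  assumes "e \<in> edges G"
  shows "loop1 G e \<longleftrightarrow> sigma1 G e = e" "loop_w G e \<longleftrightarrow> sigma_w G e = e"
    "loop_w2 G e \<longleftrightarrow> sigma_w2 G e = e"
  using assms
  by (simp_all add: loop1_def loop_w_def loop_w2_def in_star_def a_face_def c_face_def
      orbit_eq_singleton_iff)

lemma ultraloop_iff: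
  assumes G: "alternating_dimap G" and e: "e \<in> edges G"
  shows "ultraloop G e \<longleftrightarrow> sigma1 G e = e \<and> sigma_w G e = e \<and> sigma_w2 G e = e"
proof
  note D = alternating_dimapD[OF G]
  assume u: "ultraloop G e"
  then have iso: "f = e" if "f \<in> edges G" "head G f = head G e" for f
    using that by (auto simp: ultraloop_def)
  have "head G (sigma1 G e) = head G e"
    unfolding head_def in_star_def by (rule permutes_orbit_eq[OF D(2,1)]) (rule orbit.base)
  then have s1: "sigma1 G e = e" using iso D(2) e by (simp add: permutes_in_image)
  have "head G (sigma_w G e) = head G e" using u by (simp add: ultraloop_def head_def tail_def)
  then have "sigma_w G e = e" using iso D(3) e by (simp add: permutes_in_image)
  then show "sigma1 G e = e \<and> sigma_w G e = e \<and> sigma_w2 G e = e"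
    using s1 alternating_dimap_fixed_cases[OF G, of e] by blast
next
  note D = alternating_dimapD[OF G]
  assume fixed: "sigma1 G e = e \<and> sigma_w G e = e \<and> sigma_w2 G e = e"
  then have h: "head G e = {e}" by (simp add: head_def in_star_def orbit_eq_singleton_iff)
  have t: "tail G e = head G e" using fixed by (simp add: tail_def head_def)
  have self: "f \<in> in_star G f" for f
    unfolding in_star_def using D(2,1) by (rule permutes_self_in_orbit)
  have "f = e" if "head G f = head G e \<or> tail G f = head G e" for f
    using that
  proof
    assume "head G f = head G e"
    then show "f = e" using h self[of f] by (simp add: head_def)
  next
    assume "tail G f = head G e"
    then have "sigma_w G f = e" using h self[of "sigma_w G f"] by (simp add: tail_def)
    then show "f = e" using fixed inj_eq[OF D(7), of f e] by simp
  qed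
  then show "ultraloop G e"
    using t fixed e by (auto simp: ultraloop_def triloop_def loop_iffs)
qed

text \<open>
  On triloops all minors coincide with the simultaneous deletion of \<open>e\<close> from the three
  permutations, which makes the conditions visibly symmetric.
\<close>

lemma tutte_conditions_iff:
  "tutte_conditions F w x y z \<longleftrightarrow>
     (\<forall>G H. alternating_dimap G \<and> alternating_dimap H \<and> isomorphic G H \<longrightarrow> F G = F H) \<and>
     (\<forall>G. alternating_dimap G \<and> edges G = {} \<longrightarrow> F G = 1) \<and>
     (\<forall>G. alternating_dimap G \<longrightarrow> (\<forall>e\<in>edges G.
        (sigma1 G e = e \<and> sigma_w G e = e \<and> sigma_w2 G e = e \<longrightarrow>
           F G = w * F (remove_ultraloop G e)) \<and>
        (sigma1 G e = e \<and> sigma_w G e \<noteq> e \<and> sigma_w2 G e \<noteq> e \<longrightarrow>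
           F G = x * F (remove_ultraloop G e)) \<and>
        (sigma1 G e \<noteq> e \<and> sigma_w G e = e \<and> sigma_w2 G e \<noteq> e \<longrightarrow>
           F G = y * F (remove_ultraloop G e)) \<and>
        (sigma1 G e \<noteq> e \<and> sigma_w G e \<noteq> e \<and> sigma_w2 G e = e \<longrightarrow>
           F G = z * F (remove_ultraloop G e)) \<and>
        (sigma1 G e \<noteq> e \<and> sigma_w G e \<noteq> e \<and> sigma_w2 G e \<noteq> e \<longrightarrow>
           F G = F (minor1 G e) + F (minor_w G e) + F (minor_w2 G e))))"
proof -
  define P where "P G e \<longleftrightarrow>
        (ultraloop G e \<longrightarrow> F G = w * F (remove_ultraloop G e)) \<and>
        (loop1 G e \<and> \<not> ultraloop G e \<longrightarrow> F G = x * F (minor1 G e)) \<and>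
        (loop_w G e \<and> \<not> ultraloop G e \<longrightarrow> F G = y * F (minor_w G e)) \<and>
        (loop_w2 G e \<and> \<not> ultraloop G e \<longrightarrow> F G = z * F (minor_w2 G e)) \<and>
        (\<not> ultraloop G e \<and> \<not> triloop G e \<longrightarrow>
           F G = F (minor1 G e) + F (minor_w G e) + F (minor_w2 G e))" for G e
  define Q where "Q G e \<longleftrightarrow>
        (sigma1 G e = e \<and> sigma_w G e = e \<and> sigma_w2 G e = e \<longrightarrow>
           F G = w * F (remove_ultraloop G e)) \<and>
        (sigma1 G e = e \<and> sigma_w G e \<noteq> e \<and> sigma_w2 G e \<noteq> e \<longrightarrow>
           F G = x * F (remove_ultraloop G e)) \<and>
        (sigma1 G e \<noteq> e \<and> sigma_w G e = e \<and> sigma_w2 G e \<noteq> e \<longrightarrow>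
           F G = y * F (remove_ultraloop G e)) \<and>
        (sigma1 G e \<noteq> e \<and> sigma_w G e \<noteq> e \<and> sigma_w2 G e = e \<longrightarrow>
           F G = z * F (remove_ultraloop G e)) \<and>
        (sigma1 G e \<noteq> e \<and> sigma_w G e \<noteq> e \<and> sigma_w2 G e \<noteq> e \<longrightarrow>
           F G = F (minor1 G e) + F (minor_w G e) + F (minor_w2 G e))" for G e
  have PQ: "P G e \<longleftrightarrow> Q G e" if G: "alternating_dimap G" and e: "e \<in> edges G" for G e
    unfolding P_def Q_def ultraloop_iff[OF G e] triloop_def loop_iffs[OF e]
    using alternating_dimap_fixed_cases[OF G, of e] minor_triloop(2-4)[OF G, of e]
    by (elim disjE conjE) simp_all
  have "(\<forall>G. alternating_dimap G \<longrightarrow> (\<forall>e\<in>edges G. P G e)) \<longleftrightarrow>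
      (\<forall>G. alternating_dimap G \<longrightarrow> (\<forall>e\<in>edges G. Q G e))"
    by (intro all_cong1 imp_cong ball_cong refl PQ)
  then show ?thesis
    unfolding tutte_conditions_def P_def Q_def by (simp only:)
qed

lemma tutte_conditionsI:
  assumes "\<And>G H. alternating_dimap G \<Longrightarrow> alternating_dimap H \<Longrightarrow> isomorphic G H \<Longrightarrow> F G = F H"
    and "\<And>G. alternating_dimap G \<Longrightarrow> edges G = {} \<Longrightarrow> F G = 1"
    and "\<And>G e. alternating_dimap G \<Longrightarrow> e \<in> edges G \<Longrightarrow>
      sigma1 G e = e \<Longrightarrow> sigma_w G e = e \<Longrightarrow> sigma_w2 G e = e \<Longrightarrow>
      F G = w * F (remove_ultraloop G e)"
    and "\<And>G e. alternating_dimap G \<Longrightarrow> e \<in> edges G \<Longrightarrow>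
      sigma1 G e = e \<Longrightarrow> sigma_w G e \<noteq> e \<Longrightarrow> sigma_w2 G e \<noteq> e \<Longrightarrow>
      F G = x * F (remove_ultraloop G e)"
    and "\<And>G e. alternating_dimap G \<Longrightarrow> e \<in> edges G \<Longrightarrow>
      sigma1 G e \<noteq> e \<Longrightarrow> sigma_w G e = e \<Longrightarrow> sigma_w2 G e \<noteq> e \<Longrightarrow>
      F G = y * F (remove_ultraloop G e)"
    and "\<And>G e. alternating_dimap G \<Longrightarrow> e \<in> edges G \<Longrightarrow>
      sigma1 G e \<noteq> e \<Longrightarrow> sigma_w G e \<noteq> e \<Longrightarrow> sigma_w2 G e = e \<Longrightarrow>
      F G = z * F (remove_ultraloop G e)"
    and "\<And>G e. alternating_dimap G \<Longrightarrow> e \<in> edges G \<Longrightarrow>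
      sigma1 G e \<noteq> e \<Longrightarrow> sigma_w G e \<noteq> e \<Longrightarrow> sigma_w2 G e \<noteq> e \<Longrightarrow>
      F G = F (minor1 G e) + F (minor_w G e) + F (minor_w2 G e)"
  shows "tutte_conditions F w x y z"
  unfolding tutte_conditions_iff
  by (intro conjI allI ballI impI; elim conjE) (rule assms; assumption)+

lemma edges_minors [simp]:
  "edges (minor1 G e) = edges G - {e}" "edges (minor_w G e) = edges G - {e}"
  "edges (minor_w2 G e) = edges G - {e}" "edges (remove_ultraloop G e) = edges G - {e}"
  by (simp_all add: minor1_def minor_w_def minor_w2_def remove_ultraloop_def Let_def)

section \<open>Determination of an invariant by its constants\<close>

lemma tutte_conditions_cong:
  assumes F: "tutte_conditions F w x y z" and agree: "agree_on_dimaps F' F"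
  shows "tutte_conditions F' w x y z"
proof -
  have eq: "F' G = F G" if "alternating_dimap G" for G
    using agree that by (simp add: agree_on_dimaps_def)
  show ?thesis
    using F unfolding tutte_conditions_iff
    by (simp add: eq alternating_dimap_minors minor_triloop(1))
qed

text \<open>Any edge falls under one of the five clauses, and the right-hand sides involve only
  dimaps with one edge fewer, so induction on the number of edges applies.\<close>

lemma tutte_conditions_unique:
  assumes F: "tutte_conditions F w x y z" and F': "tutte_conditions F' w x y z"
  shows "agree_on_dimaps F F'"
proof -
  have "F G = F' G" if "alternating_dimap G" for G
    using that
  proof (induction "card (edges G)" arbitrary: G rule: less_induct)
    case less
    note G = less.prems
    show ?case
    proof (cases "edges G = {}")
      case True
      then show ?thesis using F F' G by (simp add: tutte_conditions_iff)
    next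
      case False
      then obtain e where e: "e \<in> edges G" by blast
      then have card: "card (edges G - {e}) < card (edges G)"
        using alternating_dimapD(1)[OF G] by (meson card_Diff1_less)
      have IH: "F H = F' H" if "alternating_dimap H" "edges H = edges G - {e}" for H
        using less.hyps[of H] card that by simp
      have m: "F (minor1 G e) = F' (minor1 G e)" "F (minor_w G e) = F' (minor_w G e)"
        "F (minor_w2 G e) = F' (minor_w2 G e)"
        using alternating_dimap_minors[OF G] by (simp_all add: IH)
      have r: "F (remove_ultraloop G e) = F' (remove_ultraloop G e)"
        if "sigma1 G e = e \<or> sigma_w G e = e \<or> sigma_w2 G e = e"
        using minor_triloop(1)[OF G that] by (simp add: IH)
      show ?thesis
        using alternating_dimap_fixed_cases[OF G, of e]
        by (elim disjE conjE) (use F F' G e m r in \<open>simp_all add: tutte_conditions_iff\<close>)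
    qed
  qed
  then show ?thesis by (simp add: agree_on_dimaps_def)
qed

section \<open>Rotational symmetry\<close>

text \<open>This is triality: the product identity is invariant under cyclic rotation, so in-stars,
  a-faces and c-faces can exchange roles cyclically.\<close>

definition rotate_dimap :: "'e dimap \<Rightarrow> 'e dimap" where
  "rotate_dimap G =
     \<lparr>edges = edges G, sigma1 = sigma_w G, sigma_w = sigma_w2 G, sigma_w2 = sigma1 G\<rparr>"

lemma rotate_dimap_simps [simp]:
  "edges (rotate_dimap G) = edges G" "sigma1 (rotate_dimap G) = sigma_w G"
  "sigma_w (rotate_dimap G) = sigma_w2 G" "sigma_w2 (rotate_dimap G) = sigma1 G"
  by (simp_all add: rotate_dimap_def)

lemma alternating_dimap_rotate:
  assumes "alternating_dimap G"
  shows "alternating_dimap (rotate_dimap G)"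
  using assms triple_rotate[of "sigma1 G" "sigma_w G" "sigma_w2 G"] permutes_bij
  unfolding alternating_dimap_def by auto

lemma isomorphic_rotate:
  assumes "isomorphic G H"
  shows "isomorphic (rotate_dimap G) (rotate_dimap H)"
  using assms by (auto simp: isomorphic_def dimap_iso_def)

lemma minors_rotate:
  "minor1 (rotate_dimap G) e = rotate_dimap (minor_w2 G e)"
  "minor_w (rotate_dimap G) e = rotate_dimap (minor1 G e)"
  "minor_w2 (rotate_dimap G) e = rotate_dimap (minor_w G e)"
  "remove_ultraloop (rotate_dimap G) e = rotate_dimap (remove_ultraloop G e)"
  by (simp_all add: rotate_dimap_def minor1_def minor_w_def minor_w2_def remove_ultraloop_def
      Let_def)

text \<open>A 1-loop of \<open>G\<close> is an \<omega>2-loop of the rotated dimap and therefore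
  receives \<open>z\<close>; likewise \<omega>-loops receive \<open>x\<close> and \<omega>2-loops
  receive \<open>y\<close>.\<close>

lemma tutte_conditions_rotate:
  assumes "tutte_conditions F w x y z"
  shows "tutte_conditions (F \<circ> rotate_dimap) w z x y"
proof -
  note F = assms[unfolded tutte_conditions_iff]
  show ?thesis
    unfolding tutte_conditions_iff
  proof (intro conjI allI impI ballI; (elim conjE)?)
    fix G H :: "'a dimap"
    assume "alternating_dimap G" "alternating_dimap H" "isomorphic G H"
    then show "(F \<circ> rotate_dimap) G = (F \<circ> rotate_dimap) H"
      using F alternating_dimap_rotate isomorphic_rotate by (metis comp_apply)
  next
    fix G :: "'a dimap"
    assume "alternating_dimap G" "edges G = {}"
    then show "(F \<circ> rotate_dimap) G = 1"
      using F alternating_dimap_rotate[of G] by simp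
  next
    fix G :: "'a dimap" and e
    assume G: "alternating_dimap G" and e: "e \<in> edges G"
    note R = F[THEN conjunct2, THEN conjunct2, rule_format, OF alternating_dimap_rotate[OF G],
        of e, unfolded minors_rotate rotate_dimap_simps, OF e]
    { assume "sigma1 G e = e" "sigma_w G e = e" "sigma_w2 G e = e"
      then show "(F \<circ> rotate_dimap) G = w * (F \<circ> rotate_dimap) (remove_ultraloop G e)"
        using R by simp }
    { assume "sigma1 G e = e" "sigma_w G e \<noteq> e" "sigma_w2 G e \<noteq> e"
      then show "(F \<circ> rotate_dimap) G = z * (F \<circ> rotate_dimap) (remove_ultraloop G e)"
        using R by simp }
    { assume "sigma1 G e \<noteq> e" "sigma_w G e = e" "sigma_w2 G e \<noteq> e"
      then show "(F \<circ> rotate_dimap) G = x * (F \<circ> rotate_dimap) (remove_ultraloop G e)"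
        using R by simp }
    { assume "sigma1 G e \<noteq> e" "sigma_w G e \<noteq> e" "sigma_w2 G e = e"
      then show "(F \<circ> rotate_dimap) G = y * (F \<circ> rotate_dimap) (remove_ultraloop G e)"
        using R by simp }
    { assume "sigma1 G e \<noteq> e" "sigma_w G e \<noteq> e" "sigma_w2 G e \<noteq> e"
      then show "(F \<circ> rotate_dimap) G = (F \<circ> rotate_dimap) (minor1 G e) +
          (F \<circ> rotate_dimap) (minor_w G e) + (F \<circ> rotate_dimap) (minor_w2 G e)"
        using R by (simp add: add_ac) }
  qed
qed

section \<open>The five families are invariants\<close>

text \<open>An edge that is not an ultraloop is never the only edge, so both sides of its clause
  vanish whatever \<open>x\<close>, \<open>y\<close>, \<open>z\<close> are. Ultraloops are covered
  by \<open>w = 0\<close>.\<close>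

lemma tutte_conditions_zero:
  "tutte_conditions (\<lambda>G :: 'e dimap. if edges G = {} then 1 else 0) 0 x y z"
proof -
  have "edges G - {e} \<noteq> {}"
    if G: "alternating_dimap G" and e: "e \<in> edges G"
      and ne: "sigma1 G e \<noteq> e \<or> sigma_w G e \<noteq> e \<or> sigma_w2 G e \<noteq> e"
    for G :: "'e dimap" and e
  proof -
    have "sigma1 G e \<in> edges G" "sigma_w G e \<in> edges G" "sigma_w2 G e \<in> edges G"
      using alternating_dimapD(2-4)[OF G] e by (simp_all add: permutes_in_image)
    then show ?thesis using ne by blast
  qed
  moreover have "(edges G = {}) = (edges H = {})" if "isomorphic G H" for G H :: "'e dimap"
    using that by (auto simp: isomorphic_def dimap_iso_def bij_betw_def)
  ultimately show ?thesis
    by (intro tutte_conditionsI) (simp_all only: edges_minors if_False, auto)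
qed

lemma tutte_conditions_three:
  "tutte_conditions (\<lambda>G :: 'e dimap. 3 ^ card (edges G)) 3 3 3 (3 :: 'k::comm_ring_1)"
proof -
  have iso: "card (edges G) = card (edges H)" if "isomorphic G H" for G H :: "'e dimap"
    using that by (auto simp: isomorphic_def dimap_iso_def bij_betw_same_card)
  have del: "3 ^ card (edges G) = (3 * 3 ^ card (edges G - {e}) :: 'k::comm_ring_1)"
    if "alternating_dimap G" "e \<in> edges G" for G :: "'e dimap" and e
    using card.remove[OF alternating_dimapD(1)[OF that(1)] that(2)] by simp
  show ?thesis
    by (rule tutte_conditionsI) (auto dest: iso simp: del simp del: power_Suc)
qed

lemma isomorphic_card_verts:
  assumes "alternating_dimap G" "isomorphic G H"
  shows "card (verts G) = card (verts H)"
proof -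
  note D = alternating_dimapD[OF assms(1)]
  obtain h where h: "bij_betw h (edges G) (edges H)"
    and comm: "\<And>e. e \<in> edges G \<Longrightarrow> h (sigma1 G e) = sigma1 H (h e)"
    using assms(2) by (auto simp: isomorphic_def dimap_iso_def)
  have sub: "in_star G e \<subseteq> edges G" if "e \<in> edges G" for e
    unfolding in_star_def using D(2) that by (rule permutes_orbit_subset)
  have star: "in_star H (h e) = h ` in_star G e" if e: "e \<in> edges G" for e
    unfolding in_star_def
  proof (rule orbit_inverse[symmetric])
    show "e \<in> orbit (sigma1 G) e" using D(2,1) by (rule permutes_self_in_orbit)
    show "sigma1 H (h u) = h (sigma1 G u)" if "u \<in> orbit (sigma1 G) e" for u
      using comm[of u] sub[OF e] that by (auto simp: in_star_def)
  qed
  have "verts H = in_star H ` h ` edges G"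
    using h by (simp add: verts_def bij_betw_def)
  also have "\<dots> = image h ` verts G"
    unfolding verts_def image_image by (rule image_cong) (simp_all add: star)
  finally have "verts H = image h ` verts G" .
  moreover have "inj_on (image h) (verts G)"
  proof (rule inj_on_image, rule inj_on_subset)
    show "inj_on h (edges G)" using h by (rule bij_betw_imp_inj_on)
    show "\<Union> (verts G) \<subseteq> edges G" using sub by (auto simp: verts_def)
  qed
  ultimately show ?thesis by (simp add: card_image)
qed

text \<open>The product of the three signs is 1, so the parity of the number of vertices can be read
  off \<open>sigma_w\<close> and \<open>sigma_w2\<close>. Contraction shortens exactly these two,
  which avoids following how it merges or splits vertices.\<close>

lemma minus_one_power_card_verts:
  assumes "alternating_dimap G"
  shows "((- 1) ^ card (verts G) :: 'k::comm_ring_1) =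
    of_int (sign (sigma_w G) * sign (sigma_w2 G)) * (- 1) ^ card (edges G)"
proof -
  note D = alternating_dimapD[OF assms]
  have p: "permutation (sigma1 G)" "permutation (sigma_w G)" "permutation (sigma_w2 G)"
    using D(1-4) by (simp_all add: permutes_imp_permutation[of "edges G"])
  have "sign (sigma1 G \<circ> sigma_w G \<circ> sigma_w2 G) = 1"
    using assms by (simp add: alternating_dimap_def)
  then have "sign (sigma1 G) * (sign (sigma_w G) * sign (sigma_w2 G)) = 1"
    using p by (simp add: sign_compose permutation_compose mult.assoc)
  then have "sign (sigma1 G) = sign (sigma_w G) * sign (sigma_w2 G)"
    by (auto simp: sign_def split: if_splits)
  then show ?thesis
    using minus_one_power_card_orbits[OF D(1,2), where 'k = 'k]
    by (simp add: verts_def in_star_def[abs_def])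
qed

lemma tutte_conditions_verts:
  "tutte_conditions (\<lambda>G :: 'e dimap. (- 1) ^ card (verts G)) (- 1) (- 1) 1 (1 :: 'k::comm_ring_1)"
proof -
  \<comment> \<open>When \<open>e\<close> is merely deleted from \<open>sigma1\<close>, a vertex is
    lost exactly if \<open>e\<close> was its only incoming edge.\<close>
  have del: "((- 1) ^ card (verts H) :: 'k) =
      (if sigma1 G e = e then - 1 else 1) * (- 1) ^ card (verts G)"
    if G: "alternating_dimap G" and e: "e \<in> edges G"
      and H: "sigma1 H = perm_delete e (sigma1 G)" "edges H = edges G - {e}"
    for G H :: "'e dimap" and e
    using card_orbits_perm_delete[OF alternating_dimapD(2,1)[OF G] e] H
    by (simp add: verts_def in_star_def[abs_def])
  have keep:
    "((- 1) ^ card (verts (minor_w G e)) :: 'k) =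
       (if sigma1 G e = e then - 1 else 1) * (- 1) ^ card (verts G)"
    "((- 1) ^ card (verts (minor_w2 G e)) :: 'k) =
       (if sigma1 G e = e then - 1 else 1) * (- 1) ^ card (verts G)"
    "((- 1) ^ card (verts (remove_ultraloop G e)) :: 'k) =
       (if sigma1 G e = e then - 1 else 1) * (- 1) ^ card (verts G)"
    if "alternating_dimap G" "e \<in> edges G" for G :: "'e dimap" and e
    by (rule del[OF that];
        simp add: minor_w_def minor_w2_def remove_ultraloop_def Let_def)+
  \<comment> \<open>The signs of \<open>sigma_w\<close> and \<open>sigma_w2\<close> both change and
    cancel, while the number of edges drops by one. For an edge that is no triloop the three minors
    then contribute -s + s + s = s.\<close>
  have flip: "((- 1) ^ card (verts (minor1 G e)) :: 'k) = - ((- 1) ^ card (verts G))"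
    if G: "alternating_dimap G" and e: "e \<in> edges G"
      and ne: "sigma_w G e \<noteq> e" "sigma_w2 G e \<noteq> e"
    for G :: "'e dimap" and e
  proof -
    note D = alternating_dimapD[OF G]
    have "card (edges G) = Suc (card (edges G - {e}))"
      using D(1) e by (rule card.remove)
    then show ?thesis
      using ne sign_perm_delete[OF D(3,1)] sign_perm_delete[OF D(4,1)]
      unfolding minus_one_power_card_verts[OF G]
        minus_one_power_card_verts[OF alternating_dimap_minors(1)[OF G]]
      by (simp add: minor1_def Let_def)
  qed
  show ?thesis
  proof (rule tutte_conditionsI)
    fix G H :: "'e dimap"
    assume "alternating_dimap G" "isomorphic G H"
    then show "((- 1) ^ card (verts G) :: 'k) = (- 1) ^ card (verts H)"
      by (simp only: isomorphic_card_verts)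
  qed (simp_all add: flip keep, simp add: verts_def)
qed

lemma tutte_conditions_a_faces:
  "tutte_conditions (\<lambda>G :: 'e dimap. (- 1) ^ card (a_faces G)) (- 1) 1 (- 1) (1 :: 'k::comm_ring_1)"
proof -
  have "verts (rotate_dimap G) = a_faces G" for G :: "'e dimap"
    by (simp add: verts_def a_faces_def in_star_def[abs_def] a_face_def[abs_def])
  then show ?thesis
    using tutte_conditions_rotate[OF tutte_conditions_verts[where 'e = 'e and 'k = 'k]] by (simp add: comp_def)
qed

text \<open>A second rotation carries a-faces to c-faces. A proper \<omega>2-loop is itself a c-face
  that disappears with it, so the -1 falls on \<open>z\<close>, and for a-faces on \<open>y\<close>;
  the English statement pairs these two the other way round.\<close>

lemma tutte_conditions_c_faces:
  "tutte_conditions (\<lambda>G :: 'e dimap. (- 1) ^ card (c_faces G)) (- 1) 1 1 (- 1 :: 'k::comm_ring_1)"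
proof -
  have "a_faces (rotate_dimap G) = c_faces G" for G :: "'e dimap"
    by (simp add: c_faces_def a_faces_def c_face_def[abs_def] a_face_def[abs_def])
  then show ?thesis
    using tutte_conditions_rotate[OF tutte_conditions_a_faces[where 'e = 'e and 'k = 'k]]
    by (simp add: comp_def)
qed

section \<open>Constraints from small dimaps\<close>

lemma inv_transpose_comp:
  "inv (transpose a b \<circ> transpose c d) = transpose c d \<circ> transpose a b"
  by (rule inv_unique_comp) (simp_all add: fun_eq_iff)

lemma perm_delete_id [simp]: "perm_delete e id = id"
  by (simp add: perm_delete_def fun_eq_iff)

lemma perm_delete_transpose [simp]:
  "perm_delete p (transpose p q) = id" "perm_delete q (transpose p q) = id"
  by (auto simp: perm_delete_def transpose_def fun_eq_iff)

lemma perm_delete_transpose_other: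
  "r \<noteq> p \<Longrightarrow> r \<noteq> q \<Longrightarrow> perm_delete r (transpose p q) = transpose p q"
  by (simp add: perm_delete_fixed)

text \<open>For distinct edges, \<open>r\<close> is a proper 1-loop, \<open>p\<close> a proper
  \<omega>-loop and \<open>q\<close> no triloop, so two different clauses evaluate the same
  dimap.\<close>

definition three_edge_dimap :: "'e \<Rightarrow> 'e \<Rightarrow> 'e \<Rightarrow> 'e dimap" where
  "three_edge_dimap p q r =
     \<lparr>edges = {p, q, r}, sigma1 = transpose p q, sigma_w = transpose q r,
      sigma_w2 = transpose q r \<circ> transpose p q\<rparr>"

text \<open>For distinct edges these are three 3-cycles that omit \<open>n\<close>, \<open>r\<close>
  and \<open>q\<close> respectively, so \<open>n\<close>, \<open>r\<close>, \<open>q\<close> are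
  proper loops of the three kinds. Only \<open>p\<close> lies on all three cycles and is no
  triloop.\<close>

definition four_edge_dimap :: "'e \<Rightarrow> 'e \<Rightarrow> 'e \<Rightarrow> 'e \<Rightarrow> 'e dimap" where
  "four_edge_dimap n p q r =
     \<lparr>edges = {n, p, q, r},
      sigma1 = transpose p q \<circ> transpose q r,
      sigma_w = transpose n q \<circ> transpose q p,
      sigma_w2 = transpose n p \<circ> transpose p r\<rparr>"

context
  fixes F :: "'e dimap \<Rightarrow> 'k::comm_ring_1" and w x y z
  assumes F: "tutte_conditions F w x y z"
begin

lemma tutte_empty: "alternating_dimap G \<Longrightarrow> edges G = {} \<Longrightarrow> F G = 1"
  using F by (simp add: tutte_conditions_iff)

text \<open>The hypotheses name only enough fixed points to single out a clause; the product
  identity settles the rest.\<close>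

lemma tutte_step:
  assumes "alternating_dimap G" "e \<in> edges G"
  shows "sigma1 G e = e \<Longrightarrow> sigma_w G e = e \<Longrightarrow> F G = w * F (remove_ultraloop G e)"
    "sigma1 G e = e \<Longrightarrow> sigma_w G e \<noteq> e \<Longrightarrow> F G = x * F (remove_ultraloop G e)"
    "sigma1 G e \<noteq> e \<Longrightarrow> sigma_w G e = e \<Longrightarrow> F G = y * F (remove_ultraloop G e)"
    "sigma1 G e \<noteq> e \<Longrightarrow> sigma_w G e \<noteq> e \<Longrightarrow> sigma_w2 G e \<noteq> e \<Longrightarrow>
       F G = F (minor1 G e) + F (minor_w G e) + F (minor_w2 G e)"
  using F assms alternating_dimap_fixed_cases[OF assms(1), of e]
  unfolding tutte_conditions_iff by blast+

lemma tutte_one_edge: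
  "F \<lparr>edges = {p}, sigma1 = id, sigma_w = id, sigma_w2 = id\<rparr> = w"
proof -
  let ?G = "\<lparr>edges = {p}, sigma1 = id, sigma_w = id, sigma_w2 = id\<rparr>"
  have "alternating_dimap ?G" by (simp add: alternating_dimap_def permutes_id)
  then have "F ?G = w * F (remove_ultraloop ?G p)"
    by (rule tutte_step(1)) simp_all
  moreover have "F (remove_ultraloop ?G p) = 1"
    by (rule tutte_empty) (simp_all add: alternating_dimap_def permutes_id remove_ultraloop_def)
  ultimately show ?thesis by simp
qed

lemma tutte_two_edges:
  assumes "p \<noteq> q"
  shows "F \<lparr>edges = {p, q}, sigma1 = id, sigma_w = id, sigma_w2 = id\<rparr> = w * w"
    "F \<lparr>edges = {p, q}, sigma1 = id, sigma_w = transpose p q, sigma_w2 = transpose p q\<rparr> = x * w"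
    "F \<lparr>edges = {p, q}, sigma1 = transpose p q, sigma_w = id, sigma_w2 = transpose p q\<rparr> = y * w"
proof -
  have rm: "{p, q} - {p} = {q}" using assms by blast
  show "F \<lparr>edges = {p, q}, sigma1 = id, sigma_w = id, sigma_w2 = id\<rparr> = w * w" (is "F ?G = _")
  proof -
    have "alternating_dimap ?G" by (simp add: alternating_dimap_def permutes_id)
    then have "F ?G = w * F (remove_ultraloop ?G p)" by (rule tutte_step(1)) simp_all
    then show ?thesis by (simp add: remove_ultraloop_def rm tutte_one_edge)
  qed
  show "F \<lparr>edges = {p, q}, sigma1 = id, sigma_w = transpose p q, sigma_w2 = transpose p q\<rparr> = x * w"
    (is "F ?G = _")
  proof -
    have "alternating_dimap ?G" by (simp add: alternating_dimap_def permutes_id permutes_swap_id)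
    then have "F ?G = x * F (remove_ultraloop ?G p)"
      using assms by (intro tutte_step(2)) simp_all
    then show ?thesis by (simp add: remove_ultraloop_def rm tutte_one_edge)
  qed
  show "F \<lparr>edges = {p, q}, sigma1 = transpose p q, sigma_w = id, sigma_w2 = transpose p q\<rparr> = y * w"
    (is "F ?G = _")
  proof -
    have "alternating_dimap ?G" by (simp add: alternating_dimap_def permutes_id permutes_swap_id)
    then have "F ?G = y * F (remove_ultraloop ?G p)"
      using assms by (intro tutte_step(3)) simp_all
    then show ?thesis by (simp add: remove_ultraloop_def rm tutte_one_edge)
  qed
qed

text \<open>The first value comes from removing the 1-loop \<open>r\<close> and then the
  \<omega>-loop left over. The second expands at \<open>q\<close>, whose minors contribute
  \<open>y * w\<close>, \<open>w * w\<close> and \<open>x * w\<close> in turn.\<close>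

lemma tutte_three_edges:
  assumes d: "p \<noteq> q" "q \<noteq> r" "p \<noteq> r"
  shows "F (three_edge_dimap p q r) = x * y * w"
    "F (three_edge_dimap p q r) = w * (x + y + w)"
proof -
  let ?G = "three_edge_dimap p q r"
  have G: "alternating_dimap ?G"
    by (auto simp: alternating_dimap_def three_edge_dimap_def fun_eq_iff
        intro!: permutes_compose permutes_swap_id)
  have "F ?G = x * F (remove_ultraloop ?G r)"
    using d by (intro tutte_step(2)[OF G]) (auto simp: three_edge_dimap_def)
  moreover have "remove_ultraloop ?G r =
      \<lparr>edges = {p, q}, sigma1 = transpose p q, sigma_w = id, sigma_w2 = transpose p q\<rparr>"
    using d by (auto simp: remove_ultraloop_def three_edge_dimap_def perm_delete_transpose_other
        fun_eq_iff perm_delete_def transpose_def)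
  ultimately show "F ?G = x * y * w" using d(1) by (simp add: tutte_two_edges)
  have E: "{p, q, r} - {q} = {p, r}" using d by blast
  have c: "perm_delete q (transpose q r \<circ> transpose p q) = transpose p r"
    using d by (auto simp: fun_eq_iff perm_delete_def transpose_def)
  have "F ?G = F (minor1 ?G q) + F (minor_w ?G q) + F (minor_w2 ?G q)"
    using d by (intro tutte_step(4)[OF G]) (auto simp: three_edge_dimap_def transpose_def)
  moreover have "minor1 ?G q =
      \<lparr>edges = {p, r}, sigma1 = transpose p r, sigma_w = id, sigma_w2 = transpose p r\<rparr>"
    by (simp add: minor1_def three_edge_dimap_def Let_def E c)
  moreover have "minor_w ?G q = \<lparr>edges = {p, r}, sigma1 = id, sigma_w = id, sigma_w2 = id\<rparr>"
    by (simp add: minor_w_def three_edge_dimap_def Let_def E)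
  moreover have "minor_w2 ?G q =
      \<lparr>edges = {p, r}, sigma1 = id, sigma_w = transpose p r, sigma_w2 = transpose p r\<rparr>"
    by (simp add: minor_w2_def three_edge_dimap_def Let_def E c)
  ultimately show "F ?G = w * (x + y + w)"
    using d(3) by (simp add: tutte_two_edges algebra_simps)
qed

end

text \<open>Removing \<open>n\<close> and expanding at \<open>p\<close> both lead to rotated copies
  of the three-edge dimap, whose values are already known.\<close>

lemma tutte_four_edges:
  fixes F :: "'e dimap \<Rightarrow> 'k::comm_ring_1" and n p q r :: 'e
  assumes F: "tutte_conditions F w x y z"
    and d: "distinct [n, p, q, r]"
  shows "x * (y * z * w) = y * z * w + x * y * w + z * x * w"
proof -
  let ?G = "four_edge_dimap n p q r"
  \<comment> \<open>The constants of \<open>F1\<close> are \<open>w z x y\<close> and those of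
    \<open>F2\<close> are \<open>w y z x\<close>.\<close>
  note F1 = tutte_conditions_rotate[OF F]
  note F2 = tutte_conditions_rotate[OF F1]
  have G: "alternating_dimap ?G"
    using d by (auto simp: alternating_dimap_def four_edge_dimap_def fun_eq_iff transpose_def
        intro!: permutes_compose permutes_swap_id)
  have E: "{n, p, q, r} - {n} = {q, p, r}" "{n, p, q, r} - {p} = {q, n, r}" using d by auto
  have E': "{r, q, n} = {q, n, r}" "{n, r, q} = {q, n, r}" by auto
  have a: "perm_delete n (transpose p q \<circ> transpose q r) = transpose p r \<circ> transpose q p"
    "perm_delete p (transpose p q \<circ> transpose q r) = transpose r q"
    and b: "perm_delete n (transpose n q \<circ> transpose q p) = transpose q p"
    "perm_delete p (transpose n q \<circ> transpose q p) = transpose q n"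
    and c: "perm_delete n (transpose n p \<circ> transpose p r) = transpose p r"
    "perm_delete p (transpose n p \<circ> transpose p r) = transpose n r"
    using d by (auto simp: fun_eq_iff perm_delete_def transpose_def)
  have "F ?G = x * F (remove_ultraloop ?G n)"
    using d by (intro tutte_step(2)[OF F G]) (auto simp: four_edge_dimap_def)
  moreover have "remove_ultraloop ?G n = rotate_dimap (rotate_dimap (three_edge_dimap q p r))"
    by (simp add: remove_ultraloop_def four_edge_dimap_def three_edge_dimap_def rotate_dimap_def
        E a b c)
  moreover have "F ?G = F (minor1 ?G p) + F (minor_w ?G p) + F (minor_w2 ?G p)"
    using d by (intro tutte_step(4)[OF F G]) (auto simp: four_edge_dimap_def transpose_def)
  moreover have "minor1 ?G p = rotate_dimap (rotate_dimap (three_edge_dimap q n r))"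
    by (simp add: minor1_def Let_def four_edge_dimap_def three_edge_dimap_def rotate_dimap_def
        E b c inv_transpose_comp)
  moreover have "minor_w ?G p = three_edge_dimap r q n"
    by (simp add: minor_w_def Let_def four_edge_dimap_def three_edge_dimap_def E E' a b
        inv_transpose_comp)
  moreover have "minor_w2 ?G p = rotate_dimap (three_edge_dimap n r q)"
    by (simp add: minor_w2_def Let_def four_edge_dimap_def three_edge_dimap_def rotate_dimap_def
        E E' a c inv_transpose_comp)
  moreover have "q \<noteq> p" "q \<noteq> n" "r \<noteq> q" "r \<noteq> n" using d by auto
  ultimately show ?thesis
    using d tutte_three_edges(1)[OF F, of r q n] tutte_three_edges(1)[OF F1, of n r q]
      tutte_three_edges(1)[OF F2, of q p r] tutte_three_edges(1)[OF F2, of q n r]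
    by simp
qed

lemma tutte_constants:
  fixes F :: "'e::infinite dimap \<Rightarrow> 'k::idom"
  assumes F: "tutte_conditions F w x y z" and w: "w \<noteq> 0"
  shows "w = 3 \<and> x = 3 \<and> y = 3 \<and> z = 3 \<or> w = - 1 \<and> x = - 1 \<and> y = 1 \<and> z = 1 \<or>
    w = - 1 \<and> x = 1 \<and> y = 1 \<and> z = - 1 \<or> w = - 1 \<and> x = 1 \<and> y = - 1 \<and> z = 1"
proof -
  obtain S :: "'e set" where S: "finite S" "card S = 4"
    using infinite_arbitrarily_large[OF infinite_UNIV] by blast
  then obtain l where l: "set l = S" "distinct l" using finite_distinct_list by blast
  then have "length l = Suc (Suc (Suc (Suc 0)))" using S distinct_card by fastforce
  then obtain n p q r where "l = [n, p, q, r]" by (auto simp: length_Suc_conv)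
  then have d: "distinct [n, p, q, r]" using l by simp
  note F1 = tutte_conditions_rotate[OF F]
  note F2 = tutte_conditions_rotate[OF F1]
  have "w * (x * y) = w * (x + y + w)"
    using tutte_three_edges[OF F, of p q r] d by (auto simp: mult_ac)
  then have xy: "x * y = x + y + w" using w by simp
  have "w * (z * x) = w * (z + x + w)"
    using tutte_three_edges[OF F1, of p q r] d by (auto simp: mult_ac)
  then have zx: "z * x = z + x + w" using w by simp
  have "w * (y * z) = w * (y + z + w)"
    using tutte_three_edges[OF F2, of p q r] d by (auto simp: mult_ac)
  then have yz: "y * z = y + z + w" using w by simp
  have "w * (x * y * z) = w * (x * y + y * z + z * x)"
    using tutte_four_edges[OF F d] by (simp add: algebra_simps)
  then have xyz: "x * y * z = x * y + y * z + z * x" using w by simp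
  \<comment> \<open>Subtracting two of the three-edge equations eliminates \<open>w\<close>; for
    example x y - y z = x - z.\<close>
  have "(x - z) * (y - 1) = 0" "(y - z) * (x - 1) = 0" "(x - y) * (z - 1) = 0"
    using xy yz zx by algebra+
  then have cases: "x = z \<or> y = 1" "y = z \<or> x = 1" "x = y \<or> z = 1" by auto
  show ?thesis
  proof (cases "x = y \<and> y = z")
    case True
    \<comment> \<open>With all three equal, the four-edge equation reads x^3 = 3 x^2. The root 0 is
      excluded because the three-edge equation would then give \<open>w = 0\<close>.\<close>
    then have "x * x * (x - 3) = 0" using xyz by (simp add: algebra_simps)
    moreover have "x \<noteq> 0" using xy True w by auto
    ultimately have "x = 3" by simp
    moreover from this have "w = 3" using xy True by (simp add: algebra_simps)
    ultimately show ?thesis using True by simp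
  next
    case False
    \<comment> \<open>If the three are not all equal, the factored equations force at least two of
      them to be 1.\<close>
    then consider "y = 1" "z = 1" | "x = 1" "y = 1" | "x = 1" "z = 1" using cases by auto
    then show ?thesis
    proof cases
      case 1
      then have "w = - 1" "x = - 1" using xy xyz by algebra+
      then show ?thesis using 1 by simp
    next
      case 2
      then have "w = - 1" "z = - 1" using xy xyz by algebra+
      then show ?thesis using 2 by simp
    next
      case 3
      then have "w = - 1" "y = - 1" using zx xyz by algebra+
      then show ?thesis using 3 by simp
    qed
  qed
qed

text \<open>The characterisation with constants comes first, and forgetting the constants gives the
  other conjunct. The infinite edge type provides the four distinct edges of the test dimap, and the
  integral domain allows cancelling \<open>w\<close> and splitting products.\<close>

theorem theorem23:
  fixes F :: "'e::infinite dimap \<Rightarrow> 'k::idom"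
  shows
    "(simple_tutte_invariant F \<longleftrightarrow>
        agree_on_dimaps F (\<lambda>G. if edges G = {} then 1 else 0) \<or>
        agree_on_dimaps F (\<lambda>G. 3 ^ card (edges G)) \<or>
        agree_on_dimaps F (\<lambda>G. (- 1) ^ card (verts G)) \<or>
        agree_on_dimaps F (\<lambda>G. (- 1) ^ card (c_faces G)) \<or>
        agree_on_dimaps F (\<lambda>G. (- 1) ^ card (a_faces G)))
     \<and>
     (\<forall>w x y z. tutte_conditions F w x y z \<longleftrightarrow>
        agree_on_dimaps F (\<lambda>G. if edges G = {} then 1 else 0) \<and> w = 0 \<or>
        agree_on_dimaps F (\<lambda>G. 3 ^ card (edges G)) \<and> w = 3 \<and> x = 3 \<and> y = 3 \<and> z = 3 \<or>
        agree_on_dimaps F (\<lambda>G. (- 1) ^ card (verts G)) \<and> w = - 1 \<and> x = - 1 \<and> y = 1 \<and> z = 1 \<or>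
        agree_on_dimaps F (\<lambda>G. (- 1) ^ card (c_faces G)) \<and> w = - 1 \<and> x = 1 \<and> y = 1 \<and> z = - 1 \<or>
        agree_on_dimaps F (\<lambda>G. (- 1) ^ card (a_faces G)) \<and> w = - 1 \<and> x = 1 \<and> y = - 1 \<and> z = 1)"
    (is "(_ \<longleftrightarrow> ?any) \<and> (\<forall>w x y z. _ \<longleftrightarrow> ?list w x y z)")
proof -
  have iff: "tutte_conditions F w x y z \<longleftrightarrow> ?list w x y z" for w x y z
  proof
    assume F: "tutte_conditions F w x y z"
    note agree = tutte_conditions_unique[OF F]
    show "?list w x y z"
    proof (cases "w = 0")
      case True
      \<comment> \<open>The vanishing function satisfies the conditions for the given
        \<open>x\<close>, \<open>y\<close>, \<open>z\<close>, so uniqueness applies without knowing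
        them.\<close>
      then show ?thesis using agree[of "\<lambda>G. if edges G = {} then 1 else 0"]
        by (simp add: tutte_conditions_zero)
    next
      case False
      from tutte_constants[OF F this] show ?thesis
      proof (elim disjE conjE)
        assume c: "w = 3" "x = 3" "y = 3" "z = 3"
        show ?thesis using agree[unfolded c, OF tutte_conditions_three] c by simp
      next
        assume c: "w = - 1" "x = - 1" "y = 1" "z = 1"
        show ?thesis using agree[unfolded c, OF tutte_conditions_verts] c by simp
      next
        assume c: "w = - 1" "x = 1" "y = 1" "z = - 1"
        show ?thesis using agree[unfolded c, OF tutte_conditions_c_faces] c by simp
      next
        assume c: "w = - 1" "x = 1" "y = - 1" "z = 1"
        show ?thesis using agree[unfolded c, OF tutte_conditions_a_faces] c by simp
      qed
    qed
  next
    assume "?list w x y z"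
    then show "tutte_conditions F w x y z"
      by (elim disjE conjE; hypsubst)
        (erule tutte_conditions_cong[rotated], rule tutte_conditions_zero tutte_conditions_three
          tutte_conditions_verts tutte_conditions_c_faces tutte_conditions_a_faces)+
  qed
  have "simple_tutte_invariant F \<longleftrightarrow> ?any"
  proof
    assume "simple_tutte_invariant F"
    then obtain w x y z where "tutte_conditions F w x y z"
      by (auto simp: simple_tutte_invariant_def)
    then have "?list w x y z" by (rule iff[THEN iffD1])
    then show ?any by (elim disjE conjE) simp_all
  next
    have cong: "simple_tutte_invariant F"
      if "agree_on_dimaps F F'" "tutte_conditions F' w x y z" for F' w x y z
      using tutte_conditions_cong[OF that(2,1)] unfolding simple_tutte_invariant_def by (intro exI)
    assume ?any
    then show "simple_tutte_invariant F"
      by (elim disjE)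
        (erule cong[OF _ tutte_conditions_zero] cong[OF _ tutte_conditions_three]
          cong[OF _ tutte_conditions_verts] cong[OF _ tutte_conditions_c_faces]
          cong[OF _ tutte_conditions_a_faces])+
  qed
  then show ?thesis by (intro conjI allI iff)
qed

end
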